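(* Let $\mathfrak g$ be a $2k$-dimensional symplectic filiform Lie algebra over $\mathbb R$. Then ${\rm gr}_C\mathfrak g\cong\mathfrak m_0(2k)$.
   Context: For a Lie algebra $\mathfrak g$ the descending central sequence is $C^1\mathfrak g=\mathfrak g$, $C^{i}\mathfrak g=[\mathfrak g,C^{i-1}\mathfrak g]$. An $n$-dimensional nilpotent Lie algebra is filiform if $C^{n}\mathfrak g=0$ and $C^{n-1}\mathfrak g\ne0$ (nil-index $n-1$). ${\rm gr}_C\mathfrak g=\bigoplus_i C^i\mathfrak g/C^{i+1}\mathfrak g$ is the associated graded Lie algebra with the induced bracket. $\mathfrak m_0(n)$ is the Lie algebra with basis $e_1,\dots,e_n$ and only nonzero brackets (up to skew-symmetry) $[e_1,e_i]=e_{i+1}$, $i=2,\dots,n-1$. A $2k$-dimensional Lie algebra is symplectic if it admits a non-degenerate $\omega\in\Lambda^2(\mathfrak g^* )$ closed for the Chevalley–Eilenberg differential with trivial coefficients. *)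

theory Defs
  imports "HOL-Analysis.Analysis"
begin

section \<open>Real Lie algebras and the descending central sequence\<close>

text \<open>The underlying vector space of the Lie algebra under study is a whole type of class
  \<open>real_vector\<close>.\<close>

locale real_lie_algebra =
  fixes br :: "'a::real_vector \<Rightarrow> 'a \<Rightarrow> 'a"
  assumes bilinear_br: "bilinear br"
    and alternating: "br x x = 0"
    and jacobi: "br x (br y z) + br y (br z x) + br z (br x y) = 0"

text \<open>\<open>lcs br i\<close> is \<open>C\<^sup>i\<close>, and \<open>C\<^sup>1\<close> is the whole algebra. The index 0, which has no
  counterpart in the usual numbering, is sent to the whole algebra as well, so
  \<open>C\<^sup>0 / C\<^sup>1\<close> is trivial.\<close>

fun lcs :: "('a::real_vector \<Rightarrow> 'a \<Rightarrow> 'a) \<Rightarrow> nat \<Rightarrow> 'a set" where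
  "lcs br 0 = UNIV"
| "lcs br (Suc 0) = UNIV"
| "lcs br (Suc (Suc i)) = span {br x y | x y. y \<in> lcs br (Suc i)}"

text \<open>No algebra of dimension 0 satisfies this: there \<open>n\<close> and \<open>n - 1\<close> coincide.\<close>

definition filiform :: "('a::real_vector \<Rightarrow> 'a \<Rightarrow> 'a) \<Rightarrow> nat \<Rightarrow> bool" where
  "filiform br n \<longleftrightarrow>
     real_lie_algebra br \<and>
     (\<exists>B. finite B \<and> span B = (UNIV :: 'a set)) \<and> dim (UNIV :: 'a set) = n \<and>
     lcs br n = {0} \<and> lcs br (n - 1) \<noteq> {0}"


section \<open>Symplectic forms\<close>

text \<open>The Chevalley--Eilenberg differential of a 2-cochain, trivial coefficients:
  the sum over \<open>i < j\<close> of \<open>(-1)\<^bsup>i+j-1\<^esup> \<omega> ([x\<^sub>i, x\<^sub>j], \<dots>)\<close>. The opposite global sign is also in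
  use and gives the same closed forms.\<close>

definition ce_diff2 ::
  "('a::real_vector \<Rightarrow> 'a \<Rightarrow> 'a) \<Rightarrow> ('a \<Rightarrow> 'a \<Rightarrow> real) \<Rightarrow> 'a \<Rightarrow> 'a \<Rightarrow> 'a \<Rightarrow> real" where
  "ce_diff2 br \<omega> x y z = \<omega> (br x y) z - \<omega> (br x z) y + \<omega> (br y z) x"

definition symplectic_form ::
  "('a::real_vector \<Rightarrow> 'a \<Rightarrow> 'a) \<Rightarrow> ('a \<Rightarrow> 'a \<Rightarrow> real) \<Rightarrow> bool" where
  "symplectic_form br \<omega> \<longleftrightarrow>
     bilinear \<omega> \<and> (\<forall>x. \<omega> x x = 0) \<and>
     (\<forall>x. (\<forall>y. \<omega> x y = 0) \<longrightarrow> x = 0) \<and>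
     (\<forall>x y z. ce_diff2 br \<omega> x y z = 0)"

definition symplectic :: "('a::real_vector \<Rightarrow> 'a \<Rightarrow> 'a) \<Rightarrow> bool" where
  "symplectic br \<longleftrightarrow> (\<exists>\<omega>. symplectic_form br \<omega>)"


section \<open>Lie algebras on a carrier set, and isomorphism\<close>

text \<open>The associated graded algebra and \<open>\<mm>\<^sub>0(n)\<close> depend on parameters, so they are given by a
  carrier set together with operations that are meaningful on that set only.\<close>

record 'b lie_struct =
  lie_carrier :: "'b set"
  lie_add :: "'b \<Rightarrow> 'b \<Rightarrow> 'b"
  lie_smult :: "real \<Rightarrow> 'b \<Rightarrow> 'b"
  lie_bracket :: "'b \<Rightarrow> 'b \<Rightarrow> 'b"

definition lie_isomorphism :: "'b lie_struct \<Rightarrow> 'c lie_struct \<Rightarrow> ('b \<Rightarrow> 'c) \<Rightarrow> bool" where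
  "lie_isomorphism L M \<phi> \<longleftrightarrow>
     bij_betw \<phi> (lie_carrier L) (lie_carrier M) \<and>
     (\<forall>x\<in>lie_carrier L. \<forall>y\<in>lie_carrier L.
        \<phi> (lie_add L x y) = lie_add M (\<phi> x) (\<phi> y)) \<and>
     (\<forall>c. \<forall>x\<in>lie_carrier L. \<phi> (lie_smult L c x) = lie_smult M c (\<phi> x)) \<and>
     (\<forall>x\<in>lie_carrier L. \<forall>y\<in>lie_carrier L.
        \<phi> (lie_bracket L x y) = lie_bracket M (\<phi> x) (\<phi> y))"

definition lie_isomorphic :: "'b lie_struct \<Rightarrow> 'c lie_struct \<Rightarrow> bool" where
  "lie_isomorphic L M \<longleftrightarrow> (\<exists>\<phi>. lie_isomorphism L M \<phi>)"


section \<open>The associated graded Lie algebra\<close>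

text \<open>\<open>C\<^sup>i / C\<^bsup>i+1\<^esup>\<close> as a set of cosets.\<close>

definition gr_piece :: "('a::real_vector \<Rightarrow> 'a \<Rightarrow> 'a) \<Rightarrow> nat \<Rightarrow> 'a set set" where
  "gr_piece br i = {{x + w | w. w \<in> lcs br (Suc i)} | x. x \<in> lcs br i}"

text \<open>An element of the direct sum is a family \<open>f\<close> of cosets, \<open>f i \<in> C\<^sup>i / C\<^bsup>i+1\<^esup>\<close>, almost all
  zero; the zero of \<open>C\<^sup>i / C\<^bsup>i+1\<^esup>\<close> is the coset \<open>C\<^bsup>i+1\<^esup>\<close>. The operations collect the results
  over all choices of representatives; the summand \<open>w\<close> completes them to a full coset even when
  \<open>c = 0\<close> or when there are no terms to add. In degree \<open>m\<close>, the induced bracket is the sum over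
  \<open>i + j = m\<close>, \<open>i, j \<ge> 1\<close>, of the maps
  \<open>C\<^sup>i / C\<^bsup>i+1\<^esup> \<times> C\<^sup>j / C\<^bsup>j+1\<^esup> \<rightarrow> C\<^bsup>i+j\<^esup> / C\<^bsup>i+j+1\<^esup>\<close>. The entry in degree 0 is always the zero
  of the trivial space \<open>C\<^sup>0 / C\<^sup>1\<close>.\<close>

definition gr_C :: "('a::real_vector \<Rightarrow> 'a \<Rightarrow> 'a) \<Rightarrow> (nat \<Rightarrow> 'a set) lie_struct" where
  "gr_C br =
    \<lparr>lie_carrier = {f. (\<forall>i. f i \<in> gr_piece br i) \<and> finite {i. f i \<noteq> lcs br (Suc i)}},
     lie_add = (\<lambda>f g i. {x + y | x y. x \<in> f i \<and> y \<in> g i}),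
     lie_smult = (\<lambda>c f i. {c *\<^sub>R x + w | x w. x \<in> f i \<and> w \<in> lcs br (Suc i)}),
     lie_bracket = (\<lambda>f g m.
       {(\<Sum>i\<in>{1..<m}. br (x i) (y (m - i))) + w | x y w.
          (\<forall>i. x i \<in> f i) \<and> (\<forall>i. y i \<in> g i) \<and> w \<in> lcs br (Suc m)})\<rparr>"


section \<open>The Lie algebra \<open>\<mm>\<^sub>0(n)\<close>\<close>

text \<open>\<open>m0_coeff n i j m\<close> is the coefficient of \<open>e\<^sub>m\<close> in \<open>[e\<^sub>i, e\<^sub>j]\<close>. A vector is its family of
  coordinates in the basis \<open>e\<^sub>1, \<dots>, e\<^sub>n\<close>, extended by zero.\<close>

definition m0_coeff :: "nat \<Rightarrow> nat \<Rightarrow> nat \<Rightarrow> nat \<Rightarrow> real" where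
  "m0_coeff n i j m =
     (if i = 1 \<and> 2 \<le> j \<and> j < n \<and> m = j + 1 then 1
      else if j = 1 \<and> 2 \<le> i \<and> i < n \<and> m = i + 1 then - 1
      else 0)"

definition m0 :: "nat \<Rightarrow> (nat \<Rightarrow> real) lie_struct" where
  "m0 n =
    \<lparr>lie_carrier = {v. \<forall>i. i \<notin> {1..n} \<longrightarrow> v i = 0},
     lie_add = (\<lambda>v w i. v i + w i),
     lie_smult = (\<lambda>c v i. c * v i),
     lie_bracket = (\<lambda>v w m. \<Sum>i\<in>{1..n}. \<Sum>j\<in>{1..n}. v i * w j * m0_coeff n i j m)\<rparr>"

end

theory Submission
  imports Defs
begin

text \<open>For a generic \<open>X\<close> and a suitable \<open>Y\<close> independent of \<open>X\<close> modulo \<open>C\<^sup>2\<close>, the elements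
  \<open>E\<^sub>i = (ad X)\<^bsup>i-1\<^esup> Y\<close> with \<open>i \<ge> 2\<close> span the lines \<open>C\<^sup>i / C\<^bsup>i+1\<^esup>\<close>, and \<open>[X, E\<^sub>i] = E\<^bsub>i+1\<^esub>\<close>. So the
  claim reduces to \<open>[E\<^sub>i, E\<^sub>j] \<in> C\<^bsup>i+j+1\<^esup>\<close>, by induction on \<open>d = i + j\<close>. For \<open>d = 3\<close> this is a matter
  of choosing \<open>Y\<close>. For larger \<open>d\<close> there is a closed 2-form \<open>\<omega>\<close> whose radical contains \<open>C\<^bsup>d+1\<^esup>\<close> but
  not \<open>E\<^sub>d\<close>: if \<open>C\<^bsup>d+1\<^esup> \<noteq> 0\<close>, take \<open>\<xi>([x, y])\<close> for a linear form \<open>\<xi>\<close> that vanishes on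
  \<open>C\<^bsup>d+2\<^esup>\<close> but not at \<open>E\<^bsub>d+1\<^esub>\<close>; for the last nonzero term \<open>C\<^sup>d\<close>, take the symplectic form. The
  Jacobi identity gives \<open>[E\<^sub>i, E\<^bsub>d-i\<^esub>] \<equiv> (-1)\<^bsup>i+1\<^esup> \<alpha> E\<^sub>d\<close>, and closedness of \<open>\<omega>\<close> then forces
  \<open>\<omega>(E\<^sub>d, _) = 0\<close> unless \<open>\<alpha> = 0\<close>.\<close>

section \<open>Linear algebra\<close>

text \<open>Induction on the index set: take \<open>x\<close> outside all earlier subspaces and
  \<open>y\<close> outside the new one. Each subspace contains \<open>x + t *\<^sub>R y\<close> for
  at most one \<open>t\<close>, since two such parameters would put \<open>y\<close>, and then
  \<open>x\<close>, into it. The reals being infinite, some \<open>t\<close> remains.\<close>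

lemma exists_notin_finite_Union_subspaces:
  fixes K :: "'i \<Rightarrow> 'a::real_vector set"
  assumes "finite I" "\<And>i. i \<in> I \<Longrightarrow> subspace (K i)" "\<And>i. i \<in> I \<Longrightarrow> K i \<noteq> UNIV"
  shows "\<exists>x. \<forall>i\<in>I. x \<notin> K i"
  using assms
proof (induction I rule: finite_induct)
  case (insert j I)
  then obtain x where x: "\<forall>i\<in>I. x \<notin> K i" by auto
  from insert.prems obtain y where y: "y \<notin> K j" by auto
  define bad where "bad i = {t. x + t *\<^sub>R y \<in> K i}" for i
  have "finite (bad i)" if "i \<in> insert j I" for i
  proof (rule ccontr)
    assume "infinite (bad i)"
    then obtain s where s: "s \<in> bad i" by (metis finite.emptyI ex_in_conv)
    with \<open>infinite (bad i)\<close> have "infinite (bad i - {s})" by simp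
    then obtain t where t: "t \<in> bad i" "t \<noteq> s"
      by (metis finite.emptyI ex_in_conv Diff_iff singletonI)
    have sub: "subspace (K i)" using insert.prems that by auto
    have "(x + t *\<^sub>R y) - (x + s *\<^sub>R y) \<in> K i"
      using s t sub unfolding bad_def by (intro subspace_diff) auto
    then have "(t - s) *\<^sub>R y \<in> K i" by (simp add: algebra_simps)
    then have "(1 / (t - s)) *\<^sub>R (t - s) *\<^sub>R y \<in> K i" by (rule subspace_scale[OF sub])
    with t have yi: "y \<in> K i" by simp
    have "(x + s *\<^sub>R y) - s *\<^sub>R y \<in> K i"
      using s yi sub unfolding bad_def by (intro subspace_diff subspace_scale) auto
    with yi y x that show False by auto
  qed
  then have "finite (\<Union>i\<in>insert j I. bad i)" using insert.hyps by blast
  then obtain t where "t \<notin> (\<Union>i\<in>insert j I. bad i)"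
    using ex_new_if_finite[OF infinite_UNIV_char_0[where 'a = real]] by blast
  then show ?case unfolding bad_def by blast
qed simp

lemma exists_linear_functional_separating:
  fixes U :: "'a::real_vector set"
  assumes "subspace U" "e \<notin> U"
  shows "\<exists>\<xi> :: 'a \<Rightarrow> real. linear \<xi> \<and> (\<forall>u\<in>U. \<xi> u = 0) \<and> \<xi> e = 1"
proof -
  obtain B where B: "B \<subseteq> U" "independent B" "U \<subseteq> span B"
    using real_vector.maximal_independent_subset by blast
  have spB: "span B = U" using B assms(1) by (simp add: span_minimal subset_antisym)
  with B assms(2) have "independent (insert e B)" by (simp add: independent_insertI)
  from linear_independent_extend[OF this, where f = "\<lambda>x. if x = e then 1 else (0::real)"]
  obtain \<xi> :: "'a \<Rightarrow> real" where
    xi: "linear \<xi>" "\<forall>x\<in>insert e B. \<xi> x = (if x = e then 1 else 0)"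
    by blast
  have xi_B: "\<xi> x = 0" if "x \<in> B" for x
  proof -
    have "x \<noteq> e" using that B(1) assms(2) by blast
    with xi(2) that show ?thesis by simp
  qed
  have "\<xi> u = 0" if "u \<in> U" for u
  proof -
    have "u \<in> span B" using that spB by simp
    show ?thesis by (rule linear_eq_0_on_span[OF xi(1) xi_B \<open>u \<in> span B\<close>])
  qed
  moreover have "\<xi> e = 1" using xi(2) by simp
  ultimately show ?thesis using xi(1) by blast
qed

lemma span_insertE:
  assumes "x \<in> span (insert a S)" "subspace S"
  obtains c where "x - c *\<^sub>R a \<in> S"
  using assms by (metis span_breakdown_eq span_eq_iff)

text \<open>The type \<^typ>\<open>'a\<close> is finite-dimensional only by hypothesis, so the library's facts
  about \<^const>\<open>dim\<close> become available through a local interpretation.\<close>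

lemma finite_dimensional_if_finite_span:
  fixes B :: "'a::real_vector set"
  assumes "finite B" "span B = UNIV"
  shows "\<exists>A::'a set. finite_dimensional_vector_space scaleR A"
proof -
  obtain A where A: "A \<subseteq> B" "independent A" "B \<subseteq> span A"
    using real_vector.maximal_independent_subset[of B] by blast
  have "span A = UNIV" using A assms by (metis span_minimal subspace_span top.extremum_uniqueI)
  then have "finite_dimensional_vector_space scaleR A"
    using A assms real_vector.vector_space_axioms finite_subset
    unfolding finite_dimensional_vector_space_def finite_dimensional_vector_space_axioms_def
    by (auto simp: dependent_raw_def span_raw_def)
  then show ?thesis ..
qed

lemma dim_psubset_if_finite_span:
  fixes U W B :: "'a::real_vector set"
  assumes "finite B" "span B = UNIV" "subspace U" "subspace W" "U \<subset> W"
  shows "dim U < dim W"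
proof -
  obtain A :: "'a set" where "finite_dimensional_vector_space scaleR A"
    using finite_dimensional_if_finite_span[OF assms(1,2)] ..
  then interpret fd: finite_dimensional_vector_space scaleR A .
  show ?thesis
    using fd.dim_psubset[of U W] assms span_eq_iff[of U] span_eq_iff[of W]
    by (simp add: dim_raw_def span_raw_def)
qed

lemma dim_span_insert_if_finite_span:
  fixes U B :: "'a::real_vector set"
  assumes "finite B" "span B = UNIV" "subspace U" "e \<notin> U"
  shows "dim (span (insert e U)) = Suc (dim U)"
proof -
  obtain A :: "'a set" where "finite_dimensional_vector_space scaleR A"
    using finite_dimensional_if_finite_span[OF assms(1,2)] ..
  then interpret fd: finite_dimensional_vector_space scaleR A .
  show ?thesis
    using fd.dim_insert[of e U] assms span_eq_iff[of U] real_vector.dim_span[of "insert e U"]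
    by (simp add: dim_raw_def span_raw_def)
qed

section \<open>The descending central sequence\<close>

context real_lie_algebra
begin

abbreviation "C \<equiv> lcs br"

lemmas br_simps =
  bilinear_ladd[OF bilinear_br] bilinear_radd[OF bilinear_br]
  bilinear_lmul[OF bilinear_br] bilinear_rmul[OF bilinear_br]
  bilinear_lneg[OF bilinear_br] bilinear_rneg[OF bilinear_br]
  bilinear_lsub[OF bilinear_br] bilinear_rsub[OF bilinear_br]
  bilinear_lzero[OF bilinear_br] bilinear_rzero[OF bilinear_br]

lemma br_anticomm: "br x y = - br y x"
proof -
  have "br (x + y) (x + y) = br x y + br y x"
    by (simp only: br_simps) (simp add: alternating)
  then have "br x y + br y x = 0" by (simp only: alternating)
  then show ?thesis by (simp add: eq_neg_iff_add_eq_0)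
qed

text \<open>The Jacobi identity read as: ad of a bracket is the commutator of the ads.\<close>

lemma br_br: "br (br x y) z = br x (br y z) - br y (br x z)"
  using jacobi[of x y z] br_anticomm[of z "br x y"] br_anticomm[of z x]
  by (simp add: br_simps algebra_simps)

lemma linear_br_left: "linear (\<lambda>x. br x y)" and linear_br_right: "linear (br x)"
  using bilinear_br by (auto simp: bilinear_def)

lemma subspace_lcs: "subspace (C i)"
  by (cases "(br, i)" rule: lcs.cases) auto

lemma br_mem_lcs_Suc:
  assumes "y \<in> C i"
  shows "br x y \<in> C (Suc i)"
  using assms by (cases i) (auto intro: span_base)

text \<open>Lets inclusions of central terms be checked on the generating brackets alone.\<close>

lemma lcs_Suc_minimal:
  assumes "1 \<le> i" "subspace U" "\<And>x y. y \<in> C i \<Longrightarrow> br x y \<in> U"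
  shows "C (Suc i) \<subseteq> U"
proof -
  obtain j where "i = Suc j" using assms(1) by (cases i) auto
  then show ?thesis using assms(2,3) by (simp, intro span_minimal) auto
qed

lemma lcs_Suc_subset: "C (Suc i) \<subseteq> C i"
proof (induction i)
  case (Suc i)
  show ?case
    by (rule lcs_Suc_minimal) (use Suc br_mem_lcs_Suc subspace_lcs in auto)
qed simp

lemma lcs_antimono: "i \<le> j \<Longrightarrow> C j \<subseteq> C i"
  by (induction rule: dec_induct) (use lcs_Suc_subset in auto)

text \<open>Induction on \<open>i\<close>: on a generator [x, u] of \<open>C (Suc i)\<close>, Jacobi
  turns [[x, u], v] into [x, [u, v]] - [u, [x, v]], and the induction hypothesis applies to both
  terms. The convention \<open>C 0 = UNIV\<close> also fits the bound.\<close>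

lemma br_mem_lcs_add:
  assumes "x \<in> C i" "y \<in> C j"
  shows "br x y \<in> C (i + j)"
  using assms
proof (induction i arbitrary: x y j)
  case 0
  then show ?case using br_mem_lcs_Suc[of y j x] lcs_Suc_subset[of j] by auto
next
  case (Suc i)
  show ?case
  proof (cases "i = 0")
    case True
    with Suc.prems show ?thesis by (simp add: br_mem_lcs_Suc)
  next
    case False
    have "C (Suc i) \<subseteq> {x. \<forall>y\<in>C j. br x y \<in> C (Suc i + j)}"
    proof (rule lcs_Suc_minimal)
      show "subspace {x. \<forall>y\<in>C j. br x y \<in> C (Suc i + j)}"
        using subspace_lcs by (auto simp: subspace_def br_simps)
      fix x u assume u: "u \<in> C i"
      show "br x u \<in> {x. \<forall>y\<in>C j. br x y \<in> C (Suc i + j)}"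
      proof clarify
        fix v assume v: "v \<in> C j"
        have "br x (br u v) \<in> C (Suc i + j)"
          using br_mem_lcs_Suc[OF Suc.IH[OF u v]] by simp
        moreover have "br u (br x v) \<in> C (Suc i + j)"
          using Suc.IH[OF u br_mem_lcs_Suc[OF v]] by simp
        ultimately show "br (br x u) v \<in> C (Suc i + j)"
          by (simp add: br_br subspace_diff subspace_lcs del: lcs.simps)
      qed
    qed (use False in auto)
    with Suc.prems show ?thesis by blast
  qed
qed

lemma lcs_stationary:
  assumes "1 \<le> i" "C (Suc i) = C i" "i \<le> j"
  shows "C j = C i"
  using assms(3)
proof (induction rule: dec_induct)
  case (step j)
  have "C (Suc i) \<subseteq> C (Suc j)"
    using assms(1) step by (intro lcs_Suc_minimal subspace_lcs) (auto intro: br_mem_lcs_Suc)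
  with step assms lcs_Suc_subset[of j] show ?case by auto
qed simp

text \<open>If one element generates modulo \<open>C 2\<close>, every bracket is modulo
  \<open>C 3\<close> a multiple of [x, x] = 0.\<close>

lemma lcs_2_eq_3_if_cyclic:
  assumes "span (insert x (C 2)) = UNIV"
  shows "C 3 = C 2"
proof -
  have "C (Suc 1) \<subseteq> C 3"
  proof (rule lcs_Suc_minimal)
    fix u v
    have "\<exists>a. u - a *\<^sub>R x \<in> C 2" "\<exists>b. v - b *\<^sub>R x \<in> C 2"
      using assms span_insertE[OF _ subspace_lcs] by (metis UNIV_I)+
    then obtain a b where ab: "u - a *\<^sub>R x \<in> C 2" "v - b *\<^sub>R x \<in> C 2" by blast
    have "br u v = br u (v - b *\<^sub>R x) - b *\<^sub>R br x (u - a *\<^sub>R x)"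
      using br_anticomm[of u x] by (simp add: br_simps alternating)
    moreover have "br u (v - b *\<^sub>R x) \<in> C 3" "br x (u - a *\<^sub>R x) \<in> C 3"
      using br_mem_lcs_Suc[OF ab(2)] br_mem_lcs_Suc[OF ab(1)] by (simp_all add: numeral_3_eq_3 numeral_2_eq_2)
    ultimately show "br u v \<in> C 3" by (simp add: subspace_diff subspace_scale subspace_lcs)
  qed (auto simp: subspace_lcs)
  then show ?thesis using lcs_Suc_subset[of 2] by (auto simp: numeral_3_eq_3 numeral_2_eq_2)
qed

end

section \<open>Bases adapted to the central filtration\<close>

declare lcs.simps(3) [simp del]

context real_lie_algebra
begin

text \<open>\<open>ladder X Y i\<close> is \<open>(ad X)\<^bsup>i-1\<^esup> Y\<close>, an element of \<open>C\<^sup>i\<close>; so \<open>X\<close>, \<open>ladder X Y 1\<close>,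
  \<open>ladder X Y 2\<close>, \dots correspond to \<open>e\<^sub>1\<close>, \<open>e\<^sub>2\<close>, \<open>e\<^sub>3\<close>, \dots The value 0 at index 0 lets sums start
  at 0.\<close>

definition ladder :: "'a \<Rightarrow> 'a \<Rightarrow> nat \<Rightarrow> 'a" where
  "ladder X Y i = (if i = 0 then 0 else (br X ^^ (i - 1)) Y)"

lemma ladder_0 [simp]: "ladder X Y 0 = 0"
  and ladder_1 [simp]: "ladder X Y (Suc 0) = Y"
  by (simp_all add: ladder_def)

lemma br_ladder: "1 \<le> i \<Longrightarrow> br X (ladder X Y i) = ladder X Y (Suc i)"
  by (cases i) (simp_all add: ladder_def)

lemma ladder_mem_lcs: "ladder X Y i \<in> C i"
proof (induction i)
  case (Suc i)
  then show ?case
    by (cases "i = 0") (use br_mem_lcs_Suc[of "ladder X Y i" i X] br_ladder in auto)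
qed (simp add: subspace_0)

end

section \<open>Dimensions and generators in a filiform algebra\<close>

locale filiform_algebra = real_lie_algebra br
  for br :: "'a::real_vector \<Rightarrow> 'a \<Rightarrow> 'a" +
  fixes n :: nat
  assumes filiform: "filiform br n" and n_ge_2: "2 \<le> n"
begin

lemma lcs_n: "C n = {0}" and lcs_pred_n: "C (n - 1) \<noteq> {0}" and dim_eq_n: "dim (UNIV :: 'a set) = n"
  using filiform by (auto simp: filiform_def)

lemma finite_spanning: obtains B :: "'a set" where "finite B" "span B = UNIV"
  using filiform by (auto simp: filiform_def)

lemma lcs_ge_n: "n \<le> i \<Longrightarrow> C i = {0}"
  using lcs_antimono[of n i] lcs_n subspace_0[OF subspace_lcs[of i]] by auto

text \<open>A repetition before index \<open>n\<close> would persist and make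
  \<open>C (n - 1)\<close> equal to \<open>C n\<close>, which is zero.\<close>

lemma lcs_psubset:
  assumes "1 \<le> i" "i < n"
  shows "C (Suc i) \<subset> C i"
proof -
  have "C (Suc i) \<noteq> C i"
  proof
    assume "C (Suc i) = C i"
    have "C n = C i" "C (n - 1) = C i"
      using lcs_stationary[OF assms(1) \<open>C (Suc i) = C i\<close>, of n]
        lcs_stationary[OF assms(1) \<open>C (Suc i) = C i\<close>, of "n - 1"] assms by simp_all
    with lcs_n lcs_pred_n show False by simp
  qed
  with lcs_Suc_subset show ?thesis by auto
qed

lemma dim_psubset:
  fixes U W :: "'a set"
  assumes "subspace U" "subspace W" "U \<subset> W"
  shows "dim U < dim W"
  using finite_spanning dim_psubset_if_finite_span[OF _ _ assms] by metis

lemma dim_subset: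
  fixes U W :: "'a set"
  assumes "subspace U" "subspace W" "U \<subseteq> W"
  shows "dim U \<le> dim W"
  using dim_psubset[OF assms(1,2)] assms(3) by (cases "U = W") (auto simp: psubset_eq)

lemma dim_span_insert:
  fixes U :: "'a set"
  assumes "subspace U" "e \<notin> U"
  shows "dim (span (insert e U)) = Suc (dim U)"
  using finite_spanning dim_span_insert_if_finite_span[OF _ _ assms] by metis

text \<open>A single generator modulo \<open>C 2\<close> would make the sequence stop at
  \<open>C 2\<close>, against strict descent.\<close>

lemma span_insert_lcs_2_neq_UNIV: "span (insert X (C 2)) \<noteq> UNIV"
proof
  assume *: "span (insert X (C 2)) = UNIV"
  \<comment> \<open>Strict descent from \<open>C 2\<close> to \<open>C 3\<close> is available only
    for \<open>2 < n\<close>; for \<open>n = 2\<close> the dimension decides, as \<open>C 2\<close>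
    is zero and one vector spans at most a line.\<close>
  have "n \<noteq> 2"
  proof
    assume "n = 2"
    with lcs_n have C2: "C 2 = {0}" by simp
    have dim_0: "dim {0 :: 'a} = 0"
      using real_vector.dim_eq_card_independent[OF real_vector.independent_empty]
        real_vector.dim_span[of "{} :: 'a set"] by simp
    have "dim (span (insert X (C 2))) \<le> 1"
    proof (cases "X \<in> C 2")
      case True
      with C2 dim_0 show ?thesis by simp
    next
      case False
      from dim_span_insert[OF subspace_lcs this] C2 dim_0 show ?thesis by simp
    qed
    with * dim_eq_n \<open>n = 2\<close> show False by simp
  qed
  with lcs_2_eq_3_if_cyclic[OF *] lcs_psubset[of 2] n_ge_2 show False
    by (simp add: numeral_3_eq_3 numeral_2_eq_2)
qed

text \<open>Counting strict inclusions upwards from \<open>C n\<close>. The opposite bound counts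
  downwards from \<open>C 2\<close>, whose codimension is at least 2; together they leave exactly
  one dimension per step from \<open>C 2\<close> on.\<close>

lemma dim_lcs_ge: "1 \<le> j \<Longrightarrow> j \<le> n \<Longrightarrow> n \<le> dim (C j) + j"
proof (induction "n - j" arbitrary: j)
  case (Suc d)
  have "n \<le> dim (C (Suc j)) + Suc j" using Suc.hyps(2) by (intro Suc.hyps(1)) auto
  moreover have "dim (C (Suc j)) < dim (C j)"
    using Suc by (intro dim_psubset subspace_lcs lcs_psubset) auto
  ultimately show ?case by simp
qed auto

lemma dim_lcs_le:
  assumes "2 \<le> j" "j \<le> n"
  shows "dim (C j) + j \<le> n"
  using assms
proof (induction rule: dec_induct)
  case base
  have "C 2 \<noteq> UNIV" using lcs_psubset[of 1] n_ge_2 by (auto simp: numeral_2_eq_2)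
  then obtain x where x: "x \<notin> C 2" by auto
  obtain y where y: "y \<notin> span (insert x (C 2))"
    using span_insert_lcs_2_neq_UNIV[of x] by blast
  have "dim (span (insert y (span (insert x (C 2))))) \<le> dim (UNIV :: 'a set)"
    by (rule dim_subset) auto
  then show ?case
    using dim_span_insert[OF subspace_span y] dim_span_insert[OF subspace_lcs x] dim_eq_n by simp
next
  case (step j)
  moreover have "dim (C (Suc j)) < dim (C j)"
    using step by (intro dim_psubset subspace_lcs lcs_psubset) auto
  ultimately show ?case by simp
qed

lemma dim_lcs: "2 \<le> j \<Longrightarrow> j \<le> n \<Longrightarrow> dim (C j) = n - j"
  using dim_lcs_ge[of j] dim_lcs_le[of j] by simp

lemma lcs_eq_span_insert:
  assumes "2 \<le> i" "i < n" "e \<in> C i" "e \<notin> C (Suc i)"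
  shows "C i = span (insert e (C (Suc i)))"
proof (rule ccontr)
  assume neq: "C i \<noteq> span (insert e (C (Suc i)))"
  have "span (insert e (C (Suc i))) \<subseteq> C i"
    using assms(3) lcs_Suc_subset by (intro span_minimal subspace_lcs) auto
  with neq have "dim (span (insert e (C (Suc i)))) < dim (C i)"
    by (intro dim_psubset subspace_lcs subspace_span) auto
  with dim_span_insert[OF subspace_lcs assms(4)] dim_lcs[of i] dim_lcs[of "Suc i"] assms(1,2)
  show False by simp
qed

text \<open>For each \<open>i\<close>, the elements \<open>x\<close> with \<open>[x, C\<^sup>i] \<subseteq> C\<^bsup>i+2\<^esup>\<close> form a proper subspace; \<open>X\<close> has to
  avoid these finitely many subspaces.\<close>

lemma exists_generic:
  "\<exists>X. X \<notin> C 2 \<and> (\<forall>i. 2 \<le> i \<and> Suc i < n \<longrightarrow> \<not> br X ` C i \<subseteq> C (Suc (Suc i)))"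
proof -
  \<comment> \<open>The spare index 0 carries the requirement that \<open>X\<close> avoid
    \<open>C 2\<close>.\<close>
  define K where "K i = (if i = 0 then C 2 else {x. br x ` C i \<subseteq> C (Suc (Suc i))})" for i
  define I where "I = insert 0 {i. 2 \<le> i \<and> Suc i < n}"
  have "finite I" unfolding I_def by (simp add: finite_subset[of _ "{..n}"] subset_iff)
  moreover have "subspace (K i)" if "i \<in> I" for i
    using subspace_lcs[of 2] subspace_lcs[of "Suc (Suc i)"]
    by (auto simp: K_def subspace_def br_simps image_subset_iff)
  moreover have "K i \<noteq> UNIV" if "i \<in> I" for i
  proof (cases "i = 0")
    case True
    with lcs_psubset[of 1] n_ge_2 show ?thesis by (auto simp: K_def numeral_2_eq_2)
  next
    case False
    with that have i: "2 \<le> i" "Suc i < n" by (auto simp: I_def)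
    show ?thesis
    proof
      \<comment> \<open>All generators of \<open>C (Suc i)\<close> would then lie in
        \<open>C (Suc (Suc i))\<close>, again against strict descent.\<close>
      assume "K i = UNIV"
      then have "C (Suc i) \<subseteq> C (Suc (Suc i))"
        using i by (intro lcs_Suc_minimal subspace_lcs) (auto simp: K_def)
      with lcs_psubset[of "Suc i"] i show False by auto
    qed
  qed
  ultimately obtain X where X: "\<forall>i\<in>I. X \<notin> K i"
    using exists_notin_finite_Union_subspaces[of I K] by blast
  have "X \<notin> C 2" using X by (auto simp: I_def K_def)
  moreover have "\<not> br X ` C i \<subseteq> C (Suc (Suc i))" if "2 \<le> i" "Suc i < n" for i
    using X that by (auto simp: I_def K_def)
  ultimately show ?thesis by blast
qed

text \<open>By \<open>dim_lcs\<close>, \<open>C 2\<close> has codimension 2, and \<open>X\<close>,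
  \<open>Y\<close> are independent modulo it.\<close>

lemma frame_decomposition:
  assumes "X \<notin> C 2" "Y \<notin> span (insert X (C 2))"
  shows "\<exists>a b. u - a *\<^sub>R X - b *\<^sub>R Y \<in> C 2"
proof -
  have "span (insert Y (span (insert X (C 2)))) = UNIV"
  proof (rule ccontr)
    assume "span (insert Y (span (insert X (C 2)))) \<noteq> UNIV"
    then have "dim (span (insert Y (span (insert X (C 2))))) < dim (UNIV :: 'a set)"
      by (intro dim_psubset) auto
    then show False
      using dim_span_insert[OF subspace_span assms(2)] dim_span_insert[OF subspace_lcs assms(1)]
        dim_eq_n dim_lcs[of 2] n_ge_2 by simp
  qed
  then obtain b where "u - b *\<^sub>R Y \<in> span (insert X (C 2))"
    using span_insertE[OF _ subspace_span] by (metis UNIV_I)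
  then obtain a where "u - b *\<^sub>R Y - a *\<^sub>R X \<in> C 2" using span_insertE[OF _ subspace_lcs] by metis
  then have "u - a *\<^sub>R X - b *\<^sub>R Y \<in> C 2" by (simp add: algebra_simps)
  then show ?thesis by blast
qed

lemma lcs_2_subset_span_insert:
  assumes "X \<notin> C 2" "Y \<notin> span (insert X (C 2))"
  shows "C 2 \<subseteq> span (insert (br X Y) (C 3))"
proof -
  have "C (Suc 1) \<subseteq> span (insert (br X Y) (C 3))"
  proof (rule lcs_Suc_minimal)
    fix u v
    obtain a b where u: "u - a *\<^sub>R X - b *\<^sub>R Y \<in> C 2" using frame_decomposition[OF assms] by blast
    obtain c d where v: "v - c *\<^sub>R X - d *\<^sub>R Y \<in> C 2" using frame_decomposition[OF assms] by blast
    \<comment> \<open>Modulo \<open>C 3\<close> only the components along \<open>X\<close> and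
      \<open>Y\<close> matter; an alternating map on a plane is a determinant times its value on the
      basis.\<close>
    have "br u v = br u (v - c *\<^sub>R X - d *\<^sub>R Y) - c *\<^sub>R br X (u - a *\<^sub>R X - b *\<^sub>R Y)
        - d *\<^sub>R br Y (u - a *\<^sub>R X - b *\<^sub>R Y) + (a * d - b * c) *\<^sub>R br X Y"
      using br_anticomm[of u X] br_anticomm[of u Y] br_anticomm[of Y X]
      by (simp add: br_simps alternating algebra_simps)
    moreover have "br u (v - c *\<^sub>R X - d *\<^sub>R Y) \<in> C 3" "br X (u - a *\<^sub>R X - b *\<^sub>R Y) \<in> C 3"
        "br Y (u - a *\<^sub>R X - b *\<^sub>R Y) \<in> C 3"
      using br_mem_lcs_Suc[OF u] br_mem_lcs_Suc[OF v] by simp_all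
    ultimately show "br u v \<in> span (insert (br X Y) (C 3))"
      by (auto intro!: span_add span_diff span_scale intro: span_base)
  qed auto
  then show ?thesis by (simp add: numeral_2_eq_2)
qed

text \<open>Once \<open>ladder X Y i\<close> spans \<open>C i\<close> modulo
  \<open>C (Suc i)\<close>, a next element lying too deep would force ad X to send all of
  \<open>C i\<close> into \<open>C (Suc (Suc i))\<close>, which genericity forbids. The first step
  holds because [X, Y] spans \<open>C 2\<close> modulo \<open>C 3\<close>.\<close>

lemma ladder_notin_lcs_Suc:
  assumes "X \<notin> C 2" "Y \<notin> span (insert X (C 2))"
    and generic: "\<And>i. 2 \<le> i \<Longrightarrow> Suc i < n \<Longrightarrow> \<not> br X ` C i \<subseteq> C (Suc (Suc i))"
    and "2 \<le> i" "i < n"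
  shows "ladder X Y i \<notin> C (Suc i)"
  using assms(4,5)
proof (induction rule: dec_induct)
  case base
  have "br X Y \<notin> C 3"
  proof
    assume "br X Y \<in> C 3"
    then have "span (insert (br X Y) (C 3)) \<subseteq> C 3" by (intro span_minimal subspace_lcs) simp
    with lcs_2_subset_span_insert[OF assms(1,2)] have "C 2 \<subseteq> C 3" by (rule subset_trans)
    moreover have "C 3 \<subset> C 2" using lcs_psubset[of 2] base by simp
    ultimately show False by blast
  qed
  then show ?case using br_ladder[of 1 X Y] by (simp add: numeral_2_eq_2 numeral_3_eq_3)
next
  case (step i)
  then have E: "ladder X Y i \<notin> C (Suc i)" by simp
  have C: "C i = span (insert (ladder X Y i) (C (Suc i)))"
    using step E ladder_mem_lcs by (intro lcs_eq_span_insert) auto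
  show ?case
  proof
    assume *: "ladder X Y (Suc i) \<in> C (Suc (Suc i))"
    have "C i \<subseteq> {v. br X v \<in> C (Suc (Suc i))}"
      unfolding C
    proof (rule span_minimal)
      show "insert (ladder X Y i) (C (Suc i)) \<subseteq> {v. br X v \<in> C (Suc (Suc i))}"
        using * br_ladder[of i X Y] step(1) br_mem_lcs_Suc by auto
      show "subspace {v. br X v \<in> C (Suc (Suc i))}"
        using subspace_lcs[of "Suc (Suc i)"] by (auto simp: subspace_def br_simps)
    qed
    with generic[of i] step show False by auto
  qed
qed

end

text \<open>The last condition settles degree 3 of the vanishing claim, [E_1, E_2] in
  \<open>C 4\<close>; the argument with closed forms starts at degree 4.\<close>

locale adapted_frame = filiform_algebra br n
  for br :: "'a::real_vector \<Rightarrow> 'a \<Rightarrow> 'a" and n :: nat +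
  fixes X Y :: 'a
  assumes X_notin: "X \<notin> lcs br 2"
    and Y_notin: "Y \<notin> span (insert X (lcs br 2))"
    and generic: "\<And>i. 2 \<le> i \<Longrightarrow> Suc i < n \<Longrightarrow> \<not> br X ` lcs br i \<subseteq> lcs br (Suc (Suc i))"
    and br_Y: "br Y (br X Y) \<in> lcs br 4"

text \<open>The last condition is reached by replacing \<open>Y\<close> with \<open>Y - c X\<close>, which does not change \<open>[X, Y]\<close>.\<close>

lemma (in filiform_algebra) exists_adapted_frame: "\<exists>X Y. adapted_frame br n X Y"
proof -
  obtain X where X: "X \<notin> C 2"
    and generic: "\<And>i. 2 \<le> i \<Longrightarrow> Suc i < n \<Longrightarrow> \<not> br X ` C i \<subseteq> C (Suc (Suc i))"
    using exists_generic by blast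
  obtain Z where Z: "Z \<notin> span (insert X (C 2))"
    using span_insert_lcs_2_neq_UNIV[of X] by blast
  have XXZ: "br X (br X Z) = ladder X Z 3"
    using br_ladder[of 1 X Z] br_ladder[of 2 X Z] by (simp add: numeral_2_eq_2 numeral_3_eq_3)
  have "br Z (br X Z) \<in> C 3"
    using br_mem_lcs_Suc[OF br_mem_lcs_Suc[of Z 1 X], of Z]
    by (simp add: numeral_3_eq_3)
  moreover have "C 3 \<subseteq> span (insert (ladder X Z 3) (C 4))"
  proof (cases "3 < n")
    case True
    then show ?thesis
      using lcs_eq_span_insert[of 3 "ladder X Z 3"] ladder_mem_lcs[of X Z 3]
        ladder_notin_lcs_Suc[OF X Z generic, of 3] by simp
  next
    case False
    then show ?thesis using lcs_ge_n[of 3] by (simp add: span_zero)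
  qed
  \<comment> \<open>As \<open>ladder X Z 3\<close> is [X, [X, Z]], \<open>c\<close> is the multiple
    of \<open>X\<close> whose removal from \<open>Z\<close> pushes [Y, [X, Y]] into
    \<open>C 4\<close>.\<close>
  ultimately obtain c where c: "br Z (br X Z) - c *\<^sub>R ladder X Z 3 \<in> C 4"
    using span_insertE[OF _ subspace_lcs] by blast
  define Y where "Y = Z - c *\<^sub>R X"
  have XY: "br X Y = br X Z" by (simp add: Y_def br_simps alternating)
  have "Y \<notin> span (insert X (C 2))"
  proof
    assume "Y \<in> span (insert X (C 2))"
    then have "Y + c *\<^sub>R X \<in> span (insert X (C 2))"
      by (intro span_add span_scale) (auto intro: span_base)
    with Z show False by (simp add: Y_def)
  qed
  moreover have "br Y (br X Y) \<in> C 4"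
    using c unfolding XY XXZ[symmetric] by (simp add: Y_def br_simps)
  ultimately have "adapted_frame br n X Y"
    using X generic by unfold_locales auto
  then show ?thesis by blast
qed

section \<open>Coordinates in an adapted frame\<close>

context adapted_frame
begin

abbreviation "E \<equiv> ladder X Y"

lemma ladder_notin: "2 \<le> i \<Longrightarrow> i < n \<Longrightarrow> E i \<notin> C (Suc i)"
  using ladder_notin_lcs_Suc[OF X_notin Y_notin generic] by blast

lemma ladder_zero: "n \<le> i \<Longrightarrow> E i = 0"
  using ladder_mem_lcs[of X Y i] lcs_ge_n by auto

lemma lcs_decomposition:
  assumes "2 \<le> i" "u \<in> C i"
  shows "\<exists>c. u - c *\<^sub>R E i \<in> C (Suc i)"
proof (cases "i < n")
  case True
  then have "C i = span (insert (E i) (C (Suc i)))"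
    using assms ladder_notin ladder_mem_lcs by (intro lcs_eq_span_insert) auto
  with assms(2) span_insertE[OF _ subspace_lcs] show ?thesis by blast
next
  case False
  with assms(2) lcs_ge_n[of i] subspace_0[OF subspace_lcs] show ?thesis by (auto intro!: exI[of _ 0])
qed

text \<open>Descending induction from the zero terms, adding one line at a time. With
  \<open>U\<close> the solution space of a linear condition, it reduces the condition on
  \<open>C i\<close> to the elements \<open>E j\<close>.\<close>

lemma lcs_subset_if_ladder_mem:
  assumes "2 \<le> i" "subspace U" "\<And>j. i \<le> j \<Longrightarrow> E j \<in> U"
  shows "C i \<subseteq> U"
  using assms(1,3)
proof (induction "n - i" arbitrary: i)
  case 0
  then show ?case using lcs_ge_n[of i] subspace_0[OF assms(2)] by simp
next
  case (Suc d)
  have *: "C (Suc i) \<subseteq> U" by (rule Suc.hyps(1)) (use Suc.hyps(2) Suc.prems in auto)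
  show ?case
  proof
    fix u assume "u \<in> C i"
    with lcs_decomposition Suc.prems(1) obtain c where "u - c *\<^sub>R E i \<in> C (Suc i)" by blast
    with * have "(u - c *\<^sub>R E i) + c *\<^sub>R E i \<in> U"
      using Suc.prems(2)[of i] assms(2) by (intro subspace_add subspace_scale) auto
    then show "u \<in> U" by simp
  qed
qed

lemma eq_UNIV_if_frame_mem:
  assumes "subspace U" "X \<in> U" "\<And>j. 1 \<le> j \<Longrightarrow> E j \<in> U"
  shows "U = UNIV"
proof -
  have C2: "C 2 \<subseteq> U" by (rule lcs_subset_if_ladder_mem) (use assms in auto)
  have "u \<in> U" for u
  proof -
    obtain a b where "u - a *\<^sub>R X - b *\<^sub>R Y \<in> C 2"
      using frame_decomposition[OF X_notin Y_notin] by blast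
    with C2 have "(u - a *\<^sub>R X - b *\<^sub>R Y) + (a *\<^sub>R X + b *\<^sub>R Y) \<in> U"
      using assms(2) assms(3)[of 1] by (intro subspace_add subspace_scale assms(1)) auto
    then show "u \<in> U" by simp
  qed
  then show ?thesis by blast
qed

lemma frame_independent:
  assumes "a *\<^sub>R X + b *\<^sub>R Y \<in> C 2"
  shows "a = 0 \<and> b = 0"
proof -
  have "b = 0"
  proof (rule ccontr)
    assume "b \<noteq> 0"
    have "a *\<^sub>R X + b *\<^sub>R Y - a *\<^sub>R X \<in> span (insert X (C 2))"
      using assms by (intro span_diff span_scale) (auto intro: span_base)
    then have "b *\<^sub>R Y \<in> span (insert X (C 2))" by simp
    from span_scale[OF this, of "1 / b"] have "(1 / b) *\<^sub>R b *\<^sub>R Y \<in> span (insert X (C 2))" .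
    with \<open>b \<noteq> 0\<close> Y_notin show False by simp
  qed
  moreover have "a = 0"
  proof (rule ccontr)
    assume "a \<noteq> 0"
    have "a *\<^sub>R X \<in> C 2" using assms \<open>b = 0\<close> by simp
    from subspace_scale[OF subspace_lcs this, of "1 / a"] have "(1 / a) *\<^sub>R a *\<^sub>R X \<in> C 2" .
    with \<open>a \<noteq> 0\<close> X_notin show False by simp
  qed
  ultimately show ?thesis by simp
qed

end

section \<open>Vanishing of the remaining graded brackets\<close>

context adapted_frame
begin

text \<open>The inductive step in degree \<open>d\<close>. The form need only have
  \<open>C (Suc d)\<close> inside its radical and \<open>E d\<close> outside, so the symplectic form
  and coboundaries can both serve.\<close>

lemma ladder_br_mem_if_closed_form:
  fixes \<omega> :: "'a \<Rightarrow> 'a \<Rightarrow> real"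
  assumes bil: "bilinear \<omega>" and alt: "\<And>x. \<omega> x x = 0"
    and closed: "\<And>x y z. ce_diff2 br \<omega> x y z = 0"
    and rad: "\<And>x y. x \<in> C (Suc d) \<Longrightarrow> \<omega> x y = 0" and nonrad: "\<omega> (E d) z \<noteq> 0"
    and d: "4 \<le> d"
    and IH: "\<And>i j. 1 \<le> i \<Longrightarrow> 1 \<le> j \<Longrightarrow> i + j < d \<Longrightarrow> br (E i) (E j) \<in> C (Suc (i + j))"
    and ij: "1 \<le> i" "1 \<le> j" "i + j = d"
  shows "br (E i) (E j) \<in> C (Suc d)"
proof -
  note w_simps = bilinear_ladd[OF bil] bilinear_radd[OF bil] bilinear_lmul[OF bil]
    bilinear_rmul[OF bil] bilinear_lsub[OF bil] bilinear_rsub[OF bil]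
    bilinear_lzero[OF bil] bilinear_rzero[OF bil]
  have anti: "\<omega> x y = - \<omega> y x" for x y
  proof -
    have "\<omega> (x + y) (x + y) = \<omega> x y + \<omega> y x"
      by (simp only: w_simps) (simp add: alt)
    then show ?thesis by (simp add: alt)
  qed
  have cl: "\<omega> (br x y) z - \<omega> (br x z) y + \<omega> (br y z) x = 0" for x y z
    using closed[of x y z] by (simp add: ce_diff2_def)
  have br_hi: "br (E i) (E j) \<in> C (Suc d)" if "Suc d \<le> i + j" for i j
    using br_mem_lcs_add[OF ladder_mem_lcs ladder_mem_lcs, of X Y i X Y j] lcs_antimono[OF that] by auto
  \<comment> \<open>Closedness on \<open>X\<close>, \<open>E i\<close>, \<open>E j\<close> moves one
    unit of degree from one argument to the other, up to a bracket in the radical, until one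
    argument itself lies in the radical.\<close>
  have hi: "\<omega> (E i) (E j) = 0" if "1 \<le> j" "1 \<le> i" "d + 2 \<le> i + j" for i j
    using that
  proof (induction j arbitrary: i rule: dec_induct)
    case base
    then have "E i \<in> C (Suc d)" using ladder_mem_lcs[of X Y i] lcs_antimono[of "Suc d" i] by auto
    then show ?case by (rule rad)
  next
    case (step j)
    have "\<omega> (br (E i) (E j)) X = 0" by (rule rad, rule br_hi) (use step in simp)
    moreover have "\<omega> (E (Suc i)) (E j) = 0" by (rule step.IH) (use step in auto)
    ultimately show ?case
      using cl[of X "E i" "E j"] br_ladder[of i X Y] br_ladder[of j X Y] step
        anti[of "E (Suc j)" "E i"] by simp
  qed
  have kill: "\<omega> u (E j) = 0" if "u \<in> C k" "2 \<le> k" "1 \<le> j" "d + 2 \<le> k + j" for u j k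
  proof -
    have "C k \<subseteq> {u. \<omega> u (E j) = 0}"
      by (rule lcs_subset_if_ladder_mem) (use that in \<open>auto simp: subspace_def w_simps intro!: hi\<close>)
    with that show ?thesis by auto
  qed
  have "br (E 1) (E (d - 1)) \<in> C d"
    using br_mem_lcs_add[OF ladder_mem_lcs ladder_mem_lcs, of X Y 1 X Y "d - 1"] d by simp
  then obtain \<alpha> where \<alpha>: "br (E 1) (E (d - 1)) - \<alpha> *\<^sub>R E d \<in> C (Suc d)"
    using lcs_decomposition[of d] d by auto
  have seq: "br (E i) (E (d - i)) - ((-1) ^ Suc i * \<alpha>) *\<^sub>R E d \<in> C (Suc d)"
    if "1 \<le> i" "i < d" for i
    using that
  proof (induction i rule: dec_induct)
    case base
    then show ?case using \<alpha> by simp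
  next
    case (step i)
    have eq: "Suc (d - Suc i) = d - i" using step by simp
    \<comment> \<open>This bracket has degree \<open>d - 1\<close>, so ad X sends it into
      \<open>C (Suc d)\<close>; what Jacobi leaves is the sign change from \<open>i\<close> to
      \<open>Suc i\<close>.\<close>
    have "br (E i) (E (d - Suc i)) \<in> C (Suc (i + (d - Suc i)))" using step by (intro IH) auto
    then have "br (E i) (E (d - Suc i)) \<in> C d" using step by simp
    then have "br X (br (E i) (E (d - Suc i))) \<in> C (Suc d)" by (rule br_mem_lcs_Suc)
    moreover have "br (E i) (E (d - i)) - ((-1) ^ Suc i * \<alpha>) *\<^sub>R E d \<in> C (Suc d)"
      using step by simp
    ultimately have "br X (br (E i) (E (d - Suc i)))
        - (br (E i) (E (d - i)) - ((-1) ^ Suc i * \<alpha>) *\<^sub>R E d) \<in> C (Suc d)"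
      by (rule subspace_diff[OF subspace_lcs])
    moreover have "br (E (Suc i)) (E (d - Suc i))
        = br X (br (E i) (E (d - Suc i))) - br (E i) (E (d - i))"
      using br_br[of X "E i" "E (d - Suc i)"] br_ladder[of i X Y] br_ladder[of "d - Suc i" X Y]
        step eq by simp
    ultimately show ?case by (simp add: diff_diff_eq)
  qed
  have w_br: "\<omega> (br (E i) (E (d - i))) u = (-1) ^ Suc i * \<alpha> * \<omega> (E d) u" if "1 \<le> i" "i < d" for i u
    using rad[OF seq[OF that], of u] by (simp add: w_simps)
  have "\<alpha> = 0"
  proof (rule ccontr)
    assume "\<alpha> \<noteq> 0"
    \<comment> \<open>Closedness on \<open>E 1\<close>, \<open>E 2\<close>,
      \<open>E (d - 2)\<close>: by \<open>IH\<close> the first two brackets lie one step deeper than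
      their degree, hence pair to zero by \<open>kill\<close>, and the third isolates
      \<alpha>.\<close>
    have q: "\<omega> (E d) (E 1) = 0"
    proof -
      have "br (E 1) (E 2) \<in> C (Suc (1 + 2))" by (rule IH) (use d in auto)
      then have "\<omega> (br (E 1) (E 2)) (E (d - 2)) = 0" by (rule kill) (use d in auto)
      moreover have "br (E 1) (E (d - 2)) \<in> C (Suc (1 + (d - 2)))" by (rule IH) (use d in auto)
      then have "\<omega> (br (E 1) (E (d - 2))) (E 2) = 0" by (rule kill) (use d in auto)
      moreover have "\<omega> (br (E 2) (E (d - 2))) (E 1) = - \<alpha> * \<omega> (E d) (E 1)"
        using w_br[of 2 "E 1"] d by simp
      ultimately show ?thesis using cl[of "E 1" "E 2" "E (d - 2)"] \<open>\<alpha> \<noteq> 0\<close> by simp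
    qed
    \<comment> \<open>Closedness on \<open>X\<close>, \<open>E i\<close>, \<open>E (d - i)\<close>
      is a recurrence in \<open>i\<close>, started at zero by \<open>q\<close>. At
      \<open>i = d\<close> it returns to the pairing in \<open>q\<close>, now with the factor
      \<open>real d - 1\<close>, which forces \<open>\<omega> (E d) X\<close> to vanish.\<close>
    have s: "\<omega> (E i) (E (Suc d - i)) = (-1) ^ Suc i * (real i - 1) * \<alpha> * \<omega> (E d) X"
      if "1 \<le> i" "i \<le> d" for i
      using that
    proof (induction i rule: dec_induct)
      case base
      then show ?case using q anti[of "E 1" "E d"] by simp
    next
      case (step i)
      have eq: "Suc d - Suc i = d - i" "Suc (d - i) = Suc d - i" using step by auto
      have "\<omega> (E (Suc i)) (E (d - i)) - \<omega> (E (Suc d - i)) (E i)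
          + (-1) ^ Suc i * \<alpha> * \<omega> (E d) X = 0"
        using cl[of X "E i" "E (d - i)"] w_br[of i X] br_ladder[of i X Y]
          br_ladder[of "d - i" X Y] step eq by simp
      moreover have "\<omega> (E (Suc d - i)) (E i) = - \<omega> (E i) (E (Suc d - i))" by (rule anti)
      ultimately show ?case using step eq by (simp add: algebra_simps)
    qed
    have "(real d - 1) * \<alpha> * \<omega> (E d) X = 0" using s[of d] q d by simp
    then have p: "\<omega> (E d) X = 0" using \<open>\<alpha> \<noteq> 0\<close> d by simp
    \<comment> \<open>Now \<open>E d\<close> pairs to zero with \<open>X\<close> by
      \<open>p\<close>, with \<open>E 1\<close> by \<open>q\<close> and with the other
      \<open>E j\<close> by \<open>hi\<close>, so it would lie in the radical.\<close>
    have "{u. \<omega> (E d) u = 0} = UNIV"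
    proof (rule eq_UNIV_if_frame_mem)
      fix j :: nat assume "1 \<le> j"
      then show "E j \<in> {u. \<omega> (E d) u = 0}"
        using q hi[of j d] d by (cases "j = 1") auto
    qed (use p in \<open>auto simp: subspace_def w_simps\<close>)
    with nonrad show False by auto
  qed
  with seq[of i] ij show ?thesis by auto
qed

text \<open>Thus all brackets among the \<open>E i\<close> vanish in the graded algebra, and only
  those with \<open>X\<close> survive.\<close>

lemma ladder_br_mem:
  assumes "symplectic br" "1 \<le> i" "1 \<le> j"
  shows "br (E i) (E j) \<in> C (Suc (i + j))"
  using assms(2,3)
proof (induction "i + j" arbitrary: i j rule: less_induct)
  case less
  define d where "d = i + j"
  have IH: "br (E i) (E j) \<in> C (Suc (i + j))" if "1 \<le> i" "1 \<le> j" "i + j < d" for i j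
    using less.hyps that by (simp add: d_def)
  have br_Y': "br (E 1) (E 2) \<in> C 4"
    using br_Y br_ladder[of 1 X Y] by (simp add: numeral_2_eq_2)
  consider "n \<le> d" | "d = 2" | "d = 3" | "4 \<le> d" "d = n - 1" | "4 \<le> d" "Suc d < n"
    using less.prems by (simp add: d_def) linarith
  then have "br (E i) (E j) \<in> C (Suc d)"
  proof cases
    case 1
    then show ?thesis
      using br_mem_lcs_add[OF ladder_mem_lcs ladder_mem_lcs, of X Y i X Y j] lcs_ge_n[of d]
        subspace_0[OF subspace_lcs] by (simp add: d_def)
  next
    case 2
    with less.prems have "i = 1" "j = 1" by (auto simp: d_def)
    then show ?thesis using subspace_0[OF subspace_lcs] by (simp add: alternating)
  next
    case 3
    with less.prems have "i = 1 \<and> j = 2 \<or> i = 2 \<and> j = 1" by (auto simp: d_def)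
    then show ?thesis
      using br_Y' 3 subspace_neg[OF subspace_lcs br_Y'] br_anticomm[of "E 2" "E 1"] by auto
  next
    case 4
    from assms(1) obtain \<omega> where w: "bilinear \<omega>" "\<And>x. \<omega> x x = 0"
        "\<And>x. (\<And>y. \<omega> x y = 0) \<Longrightarrow> x = 0" "\<And>x y z. ce_diff2 br \<omega> x y z = 0"
      unfolding symplectic_def symplectic_form_def by metis
    \<comment> \<open>Here \<open>C (Suc d)\<close> is zero, hence inside the radical, and
      nondegeneracy keeps \<open>E d\<close> outside.\<close>
    have "Suc d = n" using 4 by simp
    then have "E d \<noteq> 0" using ladder_notin[of d] subspace_0[OF subspace_lcs] 4 by force
    then obtain z where "\<omega> (E d) z \<noteq> 0" using w(3) by blast
    then show ?thesis
      using less.prems 4 \<open>Suc d = n\<close> lcs_n bilinear_lzero[OF w(1)]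
      by (intro ladder_br_mem_if_closed_form[OF w(1,2,4) _ _ _ IH]) (auto simp: d_def)
  next
    case 5
    have "E (Suc d) \<notin> C (Suc (Suc d))" using ladder_notin[of "Suc d"] 5 by simp
    then obtain \<xi> :: "'a \<Rightarrow> real" where xi: "linear \<xi>" "\<And>u. u \<in> C (Suc (Suc d)) \<Longrightarrow> \<xi> u = 0"
        "\<xi> (E (Suc d)) = 1"
      using exists_linear_functional_separating[OF subspace_lcs] by blast
    \<comment> \<open>Up to sign the coboundary of \<xi>, so closed by Jacobi. It pairs
      \<open>E d\<close> with \<open>X\<close> to -1, and its radical contains
      \<open>C (Suc d)\<close> because \<xi> vanishes on \<open>C (Suc (Suc d))\<close>.\<close>
    define \<omega> where "\<omega> x y = \<xi> (br x y)" for x y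
    have bil: "bilinear \<omega>"
      unfolding bilinear_def \<omega>_def
    proof (intro conjI allI)
      show "linear (\<lambda>y. \<xi> (br x y))" for x
        using linear_compose[OF linear_br_right[of x] xi(1)] by (simp add: o_def)
      show "linear (\<lambda>x. \<xi> (br x y))" for y
        using linear_compose[OF linear_br_left[of y] xi(1)] by (simp add: o_def)
    qed
    have closed: "ce_diff2 br \<omega> x y z = 0" for x y z
    proof -
      have "br (br x y) z - br (br x z) y + br (br y z) x = 0"
        using br_br[of x y z] br_anticomm[of "br y z" x] br_anticomm[of "br x z" y] by simp
      then show ?thesis
        unfolding ce_diff2_def \<omega>_def using linear_0[OF xi(1)]
        by (metis linear_diff[OF xi(1)] linear_add[OF xi(1)])
    qed
    have rad: "\<omega> x y = 0" if "x \<in> C (Suc d)" for x y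
      unfolding \<omega>_def using br_mem_lcs_Suc[OF that, of y] br_anticomm[of x y] xi(2)
        linear_neg[OF xi(1)] by simp
    have nonrad: "\<omega> (E d) X \<noteq> 0"
      unfolding \<omega>_def using br_anticomm[of "E d" X] br_ladder[of d X Y] 5 xi(3)
        linear_neg[OF xi(1)] by simp
    have alt: "\<omega> x x = 0" for x by (simp add: \<omega>_def alternating linear_0[OF xi(1)])
    show ?thesis
      by (rule ladder_br_mem_if_closed_form[OF bil alt closed rad nonrad 5(1) IH])
        (use less.prems in \<open>simp_all add: d_def\<close>)
  qed
  then show ?case by (simp add: d_def)
qed

end


section \<open>The isomorphism\<close>

text \<open>Only the index pairs (1, m - 1) and (m - 1, 1) contribute to coordinate
  \<open>m\<close>.\<close>

lemma m0_bracket_eq: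
  assumes v: "v \<in> lie_carrier (m0 n)" and w: "w \<in> lie_carrier (m0 n)"
  shows "lie_bracket (m0 n) v w m = (if 3 \<le> m \<and> m \<le> n then v 1 * w (m - 1) - w 1 * v (m - 1) else 0)"
proof -
  have "(\<Sum>j\<in>{1..n}. v i * w j * m0_coeff n i j m)
      = (if i = 1 then (if 3 \<le> m \<and> m \<le> n then v 1 * w (m - 1) else 0) else 0)
        - (if i = m - 1 then (if 3 \<le> m \<and> m \<le> n then v (m - 1) * w 1 else 0) else 0)"
    if "i \<in> {1..n}" for i
  proof -
    have "v i * w j * m0_coeff n i j m
        = (if j = m - 1 then (if i = 1 \<and> 3 \<le> m \<and> m \<le> n then v 1 * w (m - 1) else 0) else 0)
        - (if j = 1 then (if i = m - 1 \<and> 3 \<le> m \<and> m \<le> n then v (m - 1) * w 1 else 0) else 0)"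
      if "j \<in> {1..n}" for j
      using \<open>i \<in> {1..n}\<close> that by (auto simp: m0_coeff_def)
    then have "(\<Sum>j\<in>{1..n}. v i * w j * m0_coeff n i j m)
        = (\<Sum>j\<in>{1..n}. (if j = m - 1 then (if i = 1 \<and> 3 \<le> m \<and> m \<le> n then v 1 * w (m - 1) else 0) else 0)
        - (if j = 1 then (if i = m - 1 \<and> 3 \<le> m \<and> m \<le> n then v (m - 1) * w 1 else 0) else 0))"
      by (rule sum.cong[OF refl])
    also have "\<dots> = (if i = 1 then (if 3 \<le> m \<and> m \<le> n then v 1 * w (m - 1) else 0) else 0)
        - (if i = m - 1 then (if 3 \<le> m \<and> m \<le> n then v (m - 1) * w 1 else 0) else 0)"
      by (auto simp: sum_subtractf)
    finally show ?thesis .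
  qed
  then have "lie_bracket (m0 n) v w m = (\<Sum>i\<in>{1..n}.
      (if i = 1 then (if 3 \<le> m \<and> m \<le> n then v 1 * w (m - 1) else 0) else 0)
        - (if i = m - 1 then (if 3 \<le> m \<and> m \<le> n then v (m - 1) * w 1 else 0) else 0))"
    by (simp add: m0_def)
  also have "\<dots> = (if 3 \<le> m \<and> m \<le> n then v 1 * w (m - 1) - w 1 * v (m - 1) else 0)"
    by (auto simp: sum_subtractf)
  finally show ?thesis .
qed

lemma m0_closed:
  assumes "v \<in> lie_carrier (m0 n)" "w \<in> lie_carrier (m0 n)"
  shows "lie_add (m0 n) v w \<in> lie_carrier (m0 n)"
    and "lie_smult (m0 n) c v \<in> lie_carrier (m0 n)"
    and "lie_bracket (m0 n) v w \<in> lie_carrier (m0 n)"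
proof -
  have "lie_bracket (m0 n) v w i = 0" if "i \<notin> {1..n}" for i
    unfolding m0_bracket_eq[OF assms] using that by auto
  then show "lie_bracket (m0 n) v w \<in> lie_carrier (m0 n)"
    by (simp add: m0_def)
qed (use assms in \<open>auto simp: m0_def\<close>)

text \<open>The map is easier to write from coordinates to cosets. Its inverse is controlled on the
  carrier only, so closure of \<open>M\<close> is what lets it be applied to results of
  operations.\<close>

lemma lie_isomorphic_if_isomorphism_from:
  assumes iso: "lie_isomorphism M L \<psi>"
    and closed: "\<And>x y. x \<in> lie_carrier M \<Longrightarrow> y \<in> lie_carrier M \<Longrightarrow> lie_add M x y \<in> lie_carrier M"
      "\<And>c x. x \<in> lie_carrier M \<Longrightarrow> lie_smult M c x \<in> lie_carrier M"
      "\<And>x y. x \<in> lie_carrier M \<Longrightarrow> y \<in> lie_carrier M \<Longrightarrow> lie_bracket M x y \<in> lie_carrier M"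
  shows "lie_isomorphic L M"
proof -
  define \<phi> where "\<phi> = inv_into (lie_carrier M) \<psi>"
  have bij: "bij_betw \<psi> (lie_carrier M) (lie_carrier L)" using iso by (simp add: lie_isomorphism_def)
  have inv: "\<phi> (\<psi> v) = v" if "v \<in> lie_carrier M" for v
    using bij that by (auto simp: \<phi>_def bij_betw_def)
  have surj: "\<exists>v\<in>lie_carrier M. x = \<psi> v" if "x \<in> lie_carrier L" for x
    using bij that by (auto simp: bij_betw_def)
  have hom: "\<psi> (lie_add M x y) = lie_add L (\<psi> x) (\<psi> y)"
      "\<psi> (lie_smult M c x) = lie_smult L c (\<psi> x)"
      "\<psi> (lie_bracket M x y) = lie_bracket L (\<psi> x) (\<psi> y)"
    if "x \<in> lie_carrier M" "y \<in> lie_carrier M" for c x y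
    using iso that by (auto simp: lie_isomorphism_def)
  have "lie_isomorphism L M \<phi>"
    unfolding lie_isomorphism_def
  proof (intro conjI ballI allI)
    show "bij_betw \<phi> (lie_carrier L) (lie_carrier M)"
      unfolding \<phi>_def by (rule bij_betw_inv_into[OF bij])
    fix x y c assume "x \<in> lie_carrier L"
    then obtain v where v: "v \<in> lie_carrier M" "x = \<psi> v" using surj by blast
    show "\<phi> (lie_smult L c x) = lie_smult M c (\<phi> x)"
      using v inv closed hom(2)[symmetric] by simp
    assume "y \<in> lie_carrier L"
    then obtain w where w: "w \<in> lie_carrier M" "y = \<psi> w" using surj by blast
    show "\<phi> (lie_add L x y) = lie_add M (\<phi> x) (\<phi> y)"
      using v w inv closed hom(1)[symmetric] by simp
    show "\<phi> (lie_bracket L x y) = lie_bracket M (\<phi> x) (\<phi> y)"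
      using v w inv closed hom(3)[symmetric] by simp
  qed
  then show ?thesis by (auto simp: lie_isomorphic_def)
qed

section \<open>Cosets and the operations of the graded algebra\<close>

context real_lie_algebra
begin

definition coset :: "nat \<Rightarrow> 'a \<Rightarrow> 'a set" where
  "coset i u = {u + w | w. w \<in> C (Suc i)}"

lemma mem_coset_iff: "x \<in> coset i u \<longleftrightarrow> x - u \<in> C (Suc i)"
  unfolding coset_def by (auto intro: exI[of _ "x - u"])

lemma coset_eq_iff: "coset i u = coset i v \<longleftrightarrow> u - v \<in> C (Suc i)"
proof
  assume "coset i u = coset i v"
  then show "u - v \<in> C (Suc i)"
    using mem_coset_iff[of u i u] mem_coset_iff[of u i v] subspace_0[OF subspace_lcs] by simp
next
  assume *: "u - v \<in> C (Suc i)"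
  have "x - u \<in> C (Suc i) \<longleftrightarrow> x - v \<in> C (Suc i)" for x
    using subspace_add[OF subspace_lcs _ *, of "x - u"] subspace_diff[OF subspace_lcs _ *, of "x - v"]
    by auto
  then show "coset i u = coset i v" by (auto simp: mem_coset_iff)
qed

lemma coset_zero: "coset i 0 = C (Suc i)"
  by (auto simp: mem_coset_iff)

lemma gr_piece_eq: "gr_piece br i = coset i ` C i"
  by (auto simp: gr_piece_def coset_def)

lemma coset_add: "{x + y | x y. x \<in> coset i u \<and> y \<in> coset i v} = coset i (u + v)"
proof (intro subset_antisym subsetI)
  fix z assume "z \<in> {x + y | x y. x \<in> coset i u \<and> y \<in> coset i v}"
  then obtain x y where "z = x + y" "x - u \<in> C (Suc i)" "y - v \<in> C (Suc i)"
    by (auto simp: mem_coset_iff)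
  then show "z \<in> coset i (u + v)"
    using subspace_add[OF subspace_lcs, of "x - u" "Suc i" "y - v"]
    by (simp add: mem_coset_iff algebra_simps)
next
  fix z assume "z \<in> coset i (u + v)"
  then have "z - v \<in> coset i u" "v \<in> coset i v"
    using subspace_0[OF subspace_lcs] by (simp_all add: mem_coset_iff algebra_simps)
  then show "z \<in> {x + y | x y. x \<in> coset i u \<and> y \<in> coset i v}"
    by (intro CollectI exI[of _ "z - v"] exI[of _ v]) simp
qed

lemma coset_smult: "{c *\<^sub>R x + w | x w. x \<in> coset i u \<and> w \<in> C (Suc i)} = coset i (c *\<^sub>R u)"
proof (intro subset_antisym subsetI)
  fix z assume "z \<in> {c *\<^sub>R x + w | x w. x \<in> coset i u \<and> w \<in> C (Suc i)}"
  then obtain x w where "z = c *\<^sub>R x + w" "x - u \<in> C (Suc i)" "w \<in> C (Suc i)"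
    by (auto simp: mem_coset_iff)
  then show "z \<in> coset i (c *\<^sub>R u)"
    using subspace_add[OF subspace_lcs subspace_scale[OF subspace_lcs], of "x - u" "Suc i" w c]
    by (simp add: mem_coset_iff algebra_simps)
next
  fix z assume "z \<in> coset i (c *\<^sub>R u)"
  then have "z - c *\<^sub>R u \<in> C (Suc i)" "u \<in> coset i u"
    using subspace_0[OF subspace_lcs] by (simp_all add: mem_coset_iff)
  then show "z \<in> {c *\<^sub>R x + w | x w. x \<in> coset i u \<and> w \<in> C (Suc i)}"
    by (intro CollectI exI[of _ u] exI[of _ "z - c *\<^sub>R u"]) simp
qed

text \<open>The induced bracket is well defined: [x, y] - [a, b] = [x, y - b] + [x - a, b], and both
  terms lie one step deeper than the total degree \<open>m\<close>.\<close>

lemma coset_br: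
  assumes a: "\<And>i. a i \<in> C i" and b: "\<And>i. b i \<in> C i"
  shows "{(\<Sum>i\<in>{1..<m}. br (x i) (y (m - i))) + w | x y w.
      (\<forall>i. x i \<in> coset i (a i)) \<and> (\<forall>i. y i \<in> coset i (b i)) \<and> w \<in> C (Suc m)}
    = coset m (\<Sum>i\<in>{1..<m}. br (a i) (b (m - i)))" (is "?L = ?R")
proof (intro subset_antisym subsetI)
  fix z assume "z \<in> ?L"
  then obtain x y w where z: "z = (\<Sum>i\<in>{1..<m}. br (x i) (y (m - i))) + w"
    and x: "\<And>i. x i - a i \<in> C (Suc i)" and y: "\<And>i. y i - b i \<in> C (Suc i)"
    and w: "w \<in> C (Suc m)"
    by (auto simp: mem_coset_iff)
  have "br (x i) (y (m - i)) - br (a i) (b (m - i)) \<in> C (Suc m)" if "i \<in> {1..<m}" for i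
  proof -
    have "x i = (x i - a i) + a i" by simp
    then have "x i \<in> C i"
      using subspace_add[OF subspace_lcs _ a] x[of i] lcs_Suc_subset by (metis subsetD)
    then have "br (x i) (y (m - i) - b (m - i)) \<in> C (i + Suc (m - i))"
      by (rule br_mem_lcs_add[OF _ y])
    moreover have "br (x i - a i) (b (m - i)) \<in> C (Suc i + (m - i))"
      by (rule br_mem_lcs_add[OF x b])
    ultimately have "br (x i) (y (m - i) - b (m - i)) + br (x i - a i) (b (m - i)) \<in> C (Suc m)"
      using that by (intro subspace_add[OF subspace_lcs]) auto
    then show ?thesis by (simp add: br_simps)
  qed
  then have "(\<Sum>i\<in>{1..<m}. br (x i) (y (m - i)) - br (a i) (b (m - i))) + w \<in> C (Suc m)"
    by (intro subspace_add[OF subspace_lcs] subspace_sum[OF subspace_lcs] w)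
  then show "z \<in> ?R" by (simp add: mem_coset_iff z sum_subtractf algebra_simps)
next
  fix z assume "z \<in> ?R"
  moreover have "u \<in> coset i u" for i u using subspace_0[OF subspace_lcs] by (simp add: mem_coset_iff)
  ultimately show "z \<in> ?L"
    by (intro CollectI exI[of _ a] exI[of _ b] exI[of _ "z - (\<Sum>i\<in>{1..<m}. br (a i) (b (m - i)))"])
      (simp add: mem_coset_iff)
qed

end

section \<open>Matching the coordinates of m_0(n) with the graded algebra\<close>

context adapted_frame
begin

text \<open>The degree \<open>i\<close> component of the vector with coordinates \<open>v\<close>,
  where e_1 becomes \<open>X\<close> and e_(i+1) becomes \<open>E i\<close>. Degree 1 thus holds two
  coordinates, every later degree one, with index shifted by one.\<close>

definition frame_part :: "(nat \<Rightarrow> real) \<Rightarrow> nat \<Rightarrow> 'a" where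
  "frame_part v i = (if i = 1 then v 1 *\<^sub>R X else 0) + v (Suc i) *\<^sub>R E i"

lemma frame_part_mem: "frame_part v i \<in> C i"
  using subspace_scale[OF subspace_lcs ladder_mem_lcs, of "v (Suc i)" X Y i] by (simp add: frame_part_def)

lemma frame_part_zero: "n \<le> i \<Longrightarrow> frame_part v i = 0"
  using ladder_zero n_ge_2 by (simp add: frame_part_def)

text \<open>Injectivity: degree 1 recovers the first two coordinates by
  \<open>frame_independent\<close>, and each later degree one more because \<open>E i\<close> is not
  in \<open>C (Suc i)\<close>.\<close>

lemma frame_part_eq:
  assumes v: "v \<in> lie_carrier (m0 n)" and w: "w \<in> lie_carrier (m0 n)"
    and eq: "\<And>i. frame_part v i - frame_part w i \<in> C (Suc i)"
  shows "v = w"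
proof
  fix j
  have "frame_part v 1 - frame_part w 1 = (v 1 - w 1) *\<^sub>R X + (v 2 - w 2) *\<^sub>R Y"
    by (simp add: frame_part_def numeral_2_eq_2 algebra_simps)
  then have low: "v 1 = w 1" "v 2 = w 2"
    using eq[of 1] frame_independent[of "v 1 - w 1" "v 2 - w 2"] by (simp_all add: numeral_2_eq_2)
  have high: "v (Suc i) = w (Suc i)" if "2 \<le> i" "i < n" for i
  proof (rule ccontr)
    assume "v (Suc i) \<noteq> w (Suc i)"
    have "frame_part v i - frame_part w i = (v (Suc i) - w (Suc i)) *\<^sub>R E i"
      using that by (simp add: frame_part_def algebra_simps)
    then have "(1 / (v (Suc i) - w (Suc i))) *\<^sub>R (v (Suc i) - w (Suc i)) *\<^sub>R E i \<in> C (Suc i)"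
      using eq[of i] by (metis subspace_scale[OF subspace_lcs])
    with \<open>v (Suc i) \<noteq> w (Suc i)\<close> ladder_notin[OF that] show False by simp
  qed
  consider "j \<notin> {1..n}" | "j = 1" | "j = 2" | "2 \<le> j - 1" "j - 1 < n" "j = Suc (j - 1)"
    by (cases "j \<in> {1..n}") (auto, linarith)
  then show "v j = w j"
  proof cases
    case 1
    with v w show ?thesis by (simp add: m0_def)
  next
    case 4
    with high[of "j - 1"] show ?thesis by simp
  qed (use low in simp_all)
qed

lemma exists_frame_part:
  assumes x: "\<And>i. x i \<in> C i"
  shows "\<exists>v\<in>lie_carrier (m0 n). \<forall>i. frame_part v i - x i \<in> C (Suc i)"
proof -
  obtain a b where ab: "x 1 - a *\<^sub>R X - b *\<^sub>R Y \<in> C 2"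
    using frame_decomposition[OF X_notin Y_notin] by blast
  obtain c where c: "\<And>i. 2 \<le> i \<Longrightarrow> x i - c i *\<^sub>R E i \<in> C (Suc i)"
    using lcs_decomposition[OF _ x] by metis
  define v where "v i = (if i \<notin> {1..n} then 0 else if i = 1 then a else if i = 2 then b else c (i - 1))" for i
  have "x i - frame_part v i \<in> C (Suc i)" for i
  proof -
    consider "i = 0" | "i = 1" | "2 \<le> i" "i < n" | "2 \<le> i" "n \<le> i" by linarith
    then show ?thesis
    proof cases
      case 1
      then show ?thesis by simp
    next
      case 2
      with ab show ?thesis using n_ge_2
        by (simp add: frame_part_def v_def numeral_2_eq_2 algebra_simps)
    next
      case 3
      with c[of i] show ?thesis by (simp add: frame_part_def v_def)
    next
      case 4
      with c[of i] show ?thesis by (simp add: frame_part_zero ladder_zero)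
    qed
  qed
  then have "frame_part v i - x i \<in> C (Suc i)" for i
    using subspace_neg[OF subspace_lcs, of "x i - frame_part v i" "Suc i"] by simp
  moreover have "v \<in> lie_carrier (m0 n)" by (simp add: m0_def v_def)
  ultimately show ?thesis by blast
qed

text \<open>The products with \<open>X\<close> are exact, by \<open>br_ladder\<close> and
  antisymmetry; the remaining product of \<open>E i\<close> and \<open>E j\<close> is absorbed by
  \<open>ladder_br_mem\<close>.\<close>

lemma br_frame_part:
  assumes "symplectic br" "1 \<le> i" "1 \<le> j"
  shows "br (frame_part v i) (frame_part w j)
    - ((if i = 1 then (v 1 * w (Suc j)) *\<^sub>R E (Suc j) else 0)
      - (if j = 1 then (w 1 * v (Suc i)) *\<^sub>R E (Suc i) else 0)) \<in> C (Suc (i + j))"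
proof -
  have "br (frame_part v i) (frame_part w j)
    = ((if i = 1 then (v 1 * w (Suc j)) *\<^sub>R E (Suc j) else 0)
      - (if j = 1 then (w 1 * v (Suc i)) *\<^sub>R E (Suc i) else 0))
      + (v (Suc i) * w (Suc j)) *\<^sub>R br (E i) (E j)"
    using br_ladder[OF assms(2), of X Y] br_ladder[OF assms(3), of X Y] br_anticomm[of "E i" X]
    by (auto simp: frame_part_def br_simps alternating algebra_simps)
  then show ?thesis
    using subspace_scale[OF subspace_lcs ladder_br_mem[OF assms]] by simp
qed

lemma sum_br_frame_part:
  assumes "symplectic br" and v: "v \<in> lie_carrier (m0 n)" and w: "w \<in> lie_carrier (m0 n)"
  shows "(\<Sum>i\<in>{1..<m}. br (frame_part v i) (frame_part w (m - i)))
    - frame_part (lie_bracket (m0 n) v w) m \<in> C (Suc m)"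
proof (cases "2 \<le> m")
  case True
  \<comment> \<open>Only the two end terms of the sum survive; for \<open>m = 2\<close> both sit at
    \<open>i = 1\<close>.\<close>
  let ?g = "\<lambda>i. (if i = 1 then (v 1 * w m) *\<^sub>R E m else 0) - (if i = m - 1 then (w 1 * v m) *\<^sub>R E m else 0)"
  have "br (frame_part v i) (frame_part w (m - i)) - ?g i \<in> C (Suc m)" if "i \<in> {1..<m}" for i
  proof -
    have g: "(if i = 1 then (v 1 * w (Suc (m - i))) *\<^sub>R E (Suc (m - i)) else 0)
        - (if m - i = 1 then (w 1 * v (Suc i)) *\<^sub>R E (Suc i) else 0) = ?g i"
      using that by (intro arg_cong2[where f = "(-)"]) auto
    have "1 \<le> i" "1 \<le> m - i" "i + (m - i) = m" using that by auto
    then show ?thesis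
      using br_frame_part[OF assms(1), of i "m - i" v w] unfolding g by simp
  qed
  then have "(\<Sum>i\<in>{1..<m}. br (frame_part v i) (frame_part w (m - i)) - ?g i) \<in> C (Suc m)"
    by (rule subspace_sum[OF subspace_lcs])
  moreover have "(\<Sum>i\<in>{1..<m}. ?g i) = (v 1 * w m - w 1 * v m) *\<^sub>R E m"
  proof -
    have "1 \<in> {1..<m}" "m - 1 \<in> {1..<m}" using True by auto
    then show ?thesis by (simp add: sum_subtractf sum.delta algebra_simps)
  qed
  \<comment> \<open>For \<open>n \<le> m\<close> the bracket in \<open>m0 n\<close> is cut off, in
    agreement with \<open>E m = 0\<close>.\<close>
  moreover have "frame_part (lie_bracket (m0 n) v w) m = (v 1 * w m - w 1 * v m) *\<^sub>R E m"
    using True ladder_zero[of m] by (auto simp: frame_part_def m0_bracket_eq[OF v w])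
  ultimately show ?thesis by (simp add: sum_subtractf)
next
  case False
  then have "m = 0 \<or> m = 1" by auto
  then show ?thesis
    using subspace_0[OF subspace_lcs] by (auto simp: frame_part_def m0_bracket_eq[OF v w])
qed

lemma lie_isomorphism_gr:
  assumes "symplectic br"
  shows "lie_isomorphism (m0 n) (gr_C br) (\<lambda>v i. coset i (frame_part v i))" (is "lie_isomorphism _ _ ?\<psi>")
  unfolding lie_isomorphism_def
proof (intro conjI ballI allI)
  show "bij_betw ?\<psi> (lie_carrier (m0 n)) (lie_carrier (gr_C br))"
  proof (rule bij_betwI')
    fix v w assume "v \<in> lie_carrier (m0 n)" "w \<in> lie_carrier (m0 n)"
    then show "?\<psi> v = ?\<psi> w \<longleftrightarrow> v = w"
      using frame_part_eq[of v w] by (metis coset_eq_iff)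
  next
    fix v
    \<comment> \<open>From degree \<open>n\<close> on the component is 0, and its coset is the zero
      of the quotient.\<close>
    have "{i. ?\<psi> v i \<noteq> C (Suc i)} \<subseteq> {..<n}"
      using frame_part_zero[of _ v] coset_zero by (auto simp: not_less[symmetric])
    then have "finite {i. ?\<psi> v i \<noteq> C (Suc i)}" by (rule finite_subset) simp
    then show "?\<psi> v \<in> lie_carrier (gr_C br)"
      by (auto simp: gr_C_def gr_piece_eq frame_part_mem)
  next
    fix f assume "f \<in> lie_carrier (gr_C br)"
    then have "\<forall>i. \<exists>u. u \<in> C i \<and> f i = coset i u" by (auto simp: gr_C_def gr_piece_eq)
    then obtain x where x: "\<And>i. x i \<in> C i" "\<And>i. f i = coset i (x i)" by metis
    from exists_frame_part[of x, OF x(1)] obtain v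
      where "v \<in> lie_carrier (m0 n)" "\<forall>i. frame_part v i - x i \<in> C (Suc i)" by blast
    then show "\<exists>v\<in>lie_carrier (m0 n). f = ?\<psi> v"
      using x(2) by (intro bexI[of _ v]) (auto simp: coset_eq_iff[symmetric])
  qed
  fix v w c
  have "frame_part (lie_add (m0 n) v w) i = frame_part v i + frame_part w i" for i
    by (simp add: frame_part_def m0_def algebra_simps)
  then show "?\<psi> (lie_add (m0 n) v w) = lie_add (gr_C br) (?\<psi> v) (?\<psi> w)"
    by (simp add: gr_C_def coset_add)
  have "frame_part (lie_smult (m0 n) c v) i = c *\<^sub>R frame_part v i" for i
    by (simp add: frame_part_def m0_def algebra_simps)
  then show "?\<psi> (lie_smult (m0 n) c v) = lie_smult (gr_C br) c (?\<psi> v)"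
    by (simp add: gr_C_def coset_smult)
  assume "v \<in> lie_carrier (m0 n)" "w \<in> lie_carrier (m0 n)"
  then have "coset m (frame_part (lie_bracket (m0 n) v w) m)
      = coset m (\<Sum>i\<in>{1..<m}. br (frame_part v i) (frame_part w (m - i)))" for m
    using sum_br_frame_part[OF assms, of v w m] by (metis coset_eq_iff)
  then show "?\<psi> (lie_bracket (m0 n) v w) = lie_bracket (gr_C br) (?\<psi> v) (?\<psi> w)"
    using coset_br[of "frame_part v" "frame_part w"] by (simp add: gr_C_def frame_part_mem)
qed

end

theorem lemma7p1:
  fixes br :: "'a::real_vector \<Rightarrow> 'a \<Rightarrow> 'a" and k :: nat
  assumes "filiform br (2 * k)"
    and "symplectic br"
  shows "lie_isomorphic (gr_C br) (m0 (2 * k))"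
proof -
  \<comment> \<open>For \<open>k = 0\<close> the conditions on indices \<open>n\<close> and
    \<open>n - 1\<close> contradict each other; this secures the bound
    \<open>2 \<le> 2 * k\<close>.\<close>
  have "k \<noteq> 0" using assms(1) by (auto simp: filiform_def)
  then have "filiform_algebra br (2 * k)"
    using assms(1) by (auto simp: filiform_def filiform_algebra_def filiform_algebra_axioms_def)
  then obtain X Y where "adapted_frame br (2 * k) X Y"
    using filiform_algebra.exists_adapted_frame by blast
  from adapted_frame.lie_isomorphism_gr[OF this assms(2)] m0_closed show ?thesis
    by (rule lie_isomorphic_if_isomorphism_from)
qed

end
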